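(* Let $d \ge 2$ be an integer and $p$ a prime, and let \[\mathcal{P}_0^+ := \bigl\{ \sigma p^e : \sigma \in \{\pm 1\},\ e \in \mathbb{Z},\ e\ge 0 \bigr\}.\] For $a\in \mathbb{Q}^*$ and $b\in \mathcal{P}_0^+$, let $\psi_{d,a,b}(z) = \frac{z}{az^d+b}$, viewed as a map $\mathbb{P}^1\to\mathbb{P}^1$. Then \[\#\textup{PrePer} \bigl( \psi_{d,a,b} , \mathbb{P}^1(\mathbb{Q}) \bigr) \le 6.\]
   Context: In homogeneous coordinates $\psi_{d,a,b}([X,Y]) = [XY^{d-1}, aX^d+bY^d]$. $\textup{PrePer}(\phi,\mathbb{P}^1(\mathbb{Q}))$ denotes the set of points $P\in\mathbb{P}^1(\mathbb{Q})$ whose forward orbit $\{\phi^n(P): n\ge 0\}$ is finite (preperiodic points). *)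

theory Defs
  imports Complex_Main "HOL-Computational_Algebra.Primes"
begin

definition proj_rel :: "('a::field) \<times> 'a \<Rightarrow> 'a \<times> 'a \<Rightarrow> bool" where
  "proj_rel P Q \<longleftrightarrow> P \<noteq> (0, 0) \<and> Q \<noteq> (0, 0) \<and>
     (\<exists>c. c \<noteq> 0 \<and> fst Q = c * fst P \<and> snd Q = c * snd P)"

lemma proj_rel_part_equivp: "part_equivp (proj_rel :: ('a::field) \<times> 'a \<Rightarrow> _)"
proof (rule part_equivpI)
  show "\<exists>x :: 'a \<times> 'a. proj_rel x x"
    by (rule exI[of _ "(1, 0)"]) (simp add: proj_rel_def exI[of _ 1])
  show "symp (proj_rel :: 'a \<times> 'a \<Rightarrow> _)"
  proof (rule sympI)
    fix P Q :: "'a \<times> 'a"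
    assume "proj_rel P Q"
    then obtain c where "P \<noteq> (0, 0)" "Q \<noteq> (0, 0)" "c \<noteq> 0"
        "fst Q = c * fst P" "snd Q = c * snd P"
      by (auto simp: proj_rel_def)
    then show "proj_rel Q P"
      unfolding proj_rel_def by (intro conjI exI[of _ "inverse c"]) auto
  qed
  show "transp (proj_rel :: 'a \<times> 'a \<Rightarrow> _)"
  proof (rule transpI)
    fix P Q R :: "'a \<times> 'a"
    assume "proj_rel P Q" "proj_rel Q R"
    then obtain c c' where "P \<noteq> (0, 0)" "R \<noteq> (0, 0)" "c \<noteq> 0" "c' \<noteq> 0"
        "fst Q = c * fst P" "snd Q = c * snd P" "fst R = c' * fst Q" "snd R = c' * snd Q"
      by (auto simp: proj_rel_def)
    then show "proj_rel P R"
      unfolding proj_rel_def by (intro conjI exI[of _ "c' * c"]) auto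
  qed
qed

text \<open>The type \<open>'k proj_line\<close> is the set of \<open>'k\<close>-rational points of the projective line.\<close>

quotient_type (overloaded) 'a proj_line = "('a::field) \<times> 'a" / partial: proj_rel
  by (rule proj_rel_part_equivp)

lift_definition affine_pt :: "'a::field \<Rightarrow> 'a proj_line" is "\<lambda>z. (z, 1)"
  by (simp add: proj_rel_def exI[of _ 1])

lift_definition infinity_pt :: "'a::field proj_line" is "(1, 0)"
  by (simp add: proj_rel_def exI[of _ 1])

text \<open>The formula defines a morphism (no common zero of the two forms) if \<open>d \<ge> 2\<close> and
  \<open>a, b\<close> are nonzero; outside this range the value is an arbitrary point.\<close>

lift_definition psi :: "nat \<Rightarrow> 'a::field \<Rightarrow> 'a \<Rightarrow> 'a proj_line \<Rightarrow> 'a proj_line" is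
  "\<lambda>d a b (X, Y).
     if d \<ge> 2 \<and> a \<noteq> 0 \<and> b \<noteq> 0 then (X * Y ^ (d - 1), a * X ^ d + b * Y ^ d) else (0, 1)"
proof -
  fix d :: nat and a b :: 'a and P Q :: "'a \<times> 'a"
  assume PQ: "proj_rel P Q"
  obtain X Y where P: "P = (X, Y)" by (cases P)
  obtain X' Y' where Q: "Q = (X', Y')" by (cases Q)
  from PQ P Q obtain c where nz: "(X, Y) \<noteq> (0, 0)" "(X', Y') \<noteq> (0, 0)"
    and c: "c \<noteq> 0" "X' = c * X" "Y' = c * Y"
    by (auto simp: proj_rel_def)
  let ?F = "\<lambda>(X, Y). if d \<ge> 2 \<and> a \<noteq> 0 \<and> b \<noteq> 0
     then (X * Y ^ (d - 1), a * X ^ d + b * Y ^ d) else (0, 1)"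
  have "proj_rel (?F (X, Y)) (?F (X', Y'))"
  proof (cases "d \<ge> 2 \<and> a \<noteq> 0 \<and> b \<noteq> 0")
    case True
    then obtain k where k: "d = Suc (Suc k)" by (metis add_2_eq_Suc le_Suc_ex)
    have ne: "(x * y ^ (d - 1), a * x ^ d + b * y ^ d) \<noteq> (0, 0)"
      if "(x, y) \<noteq> (0, 0)" for x y
      using that True by (auto simp: k)
    have "X' * Y' ^ (d - 1) = c ^ d * (X * Y ^ (d - 1))"
      by (simp add: k c power_mult_distrib algebra_simps)
    moreover have "a * X' ^ d + b * Y' ^ d = c ^ d * (a * X ^ d + b * Y ^ d)"
      by (simp add: c power_mult_distrib algebra_simps)
    ultimately have "proj_rel (X * Y ^ (d - 1), a * X ^ d + b * Y ^ d)
        (X' * Y' ^ (d - 1), a * X' ^ d + b * Y' ^ d)"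
      unfolding proj_rel_def using ne[OF nz(1)] ne[OF nz(2)] c(1)
      by (intro conjI exI[of _ "c ^ d"]) auto
    then show ?thesis using True by simp
  next
    case False
    have "proj_rel (0, 1) ((0, 1) :: 'a \<times> 'a)" by (simp add: proj_rel_def exI[of _ 1])
    then show ?thesis using False by (simp only: prod.case if_False)
  qed
  then show "proj_rel (?F P) (?F Q)" by (simp only: P Q)
qed

lemma psi_affine_pt:
  assumes "d \<ge> 2" "a \<noteq> 0" "b \<noteq> 0"
  shows "psi d a b (affine_pt z) =
    (if a * z ^ d + b = 0 then infinity_pt else affine_pt (z / (a * z ^ d + b)))"
proof (cases "a * z ^ d + b = 0")
  case True
  then have z: "z \<noteq> 0" using assms by (auto simp: power_0_left)
  from True assms z have "proj_rel (z * 1 ^ (d - 1), a * z ^ d + b * 1 ^ d) (1, 0)"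
    unfolding proj_rel_def by (intro conjI exI[of _ "inverse z"]) simp_all
  with assms have "psi d a b (affine_pt z) = infinity_pt"
    by transfer simp
  then show ?thesis using True by simp
next
  case False
  from False have "proj_rel (z * 1 ^ (d - 1), a * z ^ d + b * 1 ^ d) (z / (a * z ^ d + b), 1)"
    unfolding proj_rel_def
    by (intro conjI exI[of _ "inverse (a * z ^ d + b)"]) (simp_all add: divide_inverse mult.commute)
  with assms have "psi d a b (affine_pt z) = affine_pt (z / (a * z ^ d + b))"
    by transfer simp
  then show ?thesis using False by simp
qed

lemma psi_infinity_pt:
  assumes "d \<ge> 2" "a \<noteq> 0" "b \<noteq> 0"
  shows "psi d a b infinity_pt = affine_pt 0"
proof -
  have "proj_rel (1 * 0 ^ (d - 1), a * 1 ^ d + b * 0 ^ d) (0, 1)"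
    unfolding proj_rel_def using assms
    by (intro conjI exI[of _ "inverse a"]) (simp_all add: power_0_left)
  with assms show ?thesis
    by transfer simp
qed

definition PrePer :: "('p \<Rightarrow> 'p) \<Rightarrow> 'p set" where
  "PrePer \<phi> = {P. finite (range (\<lambda>n. (\<phi> ^^ n) P))}"

definition P0_plus :: "nat \<Rightarrow> rat set" where
  "P0_plus p = {\<sigma> * of_nat p ^ e | \<sigma> e. \<sigma> \<in> {1, -1}}"

end

theory Submission imports Defs begin

text \<open>
  Write \<open>u = a z^d\<close> and \<open>t = u + b\<close>, so that \<open>z\<close> is mapped to \<open>z' = z / t\<close> and
  \<open>t^d (t' - b) = t - b\<close>. On a cycle of nonzero points \<open>t\<close> is a unit at every prime other than \<open>p\<close>:
  a negative valuation of \<open>u\<close> becomes positive in one step and stays positive. Hence \<open>t\<close> or \<open>1 / t\<close>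
  is an integer. If \<open>\<bar>t\<bar> < 1\<close>, then \<open>t'\<close> is an integer with \<open>\<bar>t'\<bar> > \<bar>b\<bar>\<close>, and then \<open>t''\<close> lies within
  distance 1 of \<open>b\<close> without being equal to it, which is impossible. So \<open>\<bar>t\<bar> \<ge> 1\<close> along the cycle,
  and \<open>z' = z / t\<close> forces \<open>t = 1\<close> or \<open>t = - 1\<close>.

  Going backwards, size estimates and the rational root theorem show that the preimages of infinity
  have no preimages, and that a cycle has no preimages outside it unless \<open>d = 2\<close>, when there is exactly
  one further level. For even \<open>d\<close> the resulting values of \<open>u\<close> lie in the square classes of
  \<open>- b\<close>, \<open>1 - b\<close> and \<open>- 1 - b\<close>, which are pairwise distinct because \<open>b^2 - b\<close>, \<open>b^2 + b\<close> and
  \<open>b^2 - 1\<close> are not squares. So \<open>a z^d\<close> takes at most two values on the preperiodic points other than 0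
  and infinity, each at most twice.
\<close>

subsection \<open>Valuations of rational numbers\<close>

text \<open>At 0 the value is 0 instead of infinity; this is why the rules for products and sums
  assume nonzero arguments.\<close>

definition rat_val :: "int \<Rightarrow> rat \<Rightarrow> int" where
  "rat_val l x = int (multiplicity l (fst (quotient_of x))) - int (multiplicity l (snd (quotient_of x)))"

lemma rat_fraction_cases:
  fixes x :: rat
  obtains m n where "x = of_int m / of_int n" "coprime m n" "n > 0"
proof -
  obtain m n where mn: "quotient_of x = (m, n)" by (cases "quotient_of x")
  show ?thesis
    using that[OF quotient_of_div[OF mn] quotient_of_coprime[OF mn] quotient_of_denom_pos[OF mn]] .
qed

lemma rat_val_fraction:
  assumes l: "prime l" and "m \<noteq> 0" "n \<noteq> 0"
  shows "rat_val l (of_int m / of_int n) = int (multiplicity l m) - int (multiplicity l n)"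
proof -
  obtain m' n' where q: "quotient_of (of_int m / of_int n) = (m', n')"
    by (cases "quotient_of (of_int m / of_int n)")
  have n': "n' > 0" using quotient_of_denom_pos[OF q] .
  have "of_int m / of_int n = (of_int m' / of_int n' :: rat)" using quotient_of_div[OF q] .
  then have "of_int (m * n') = (of_int (m' * n) :: rat)" using n' assms by (simp add: field_simps)
  then have eq: "m * n' = m' * n" using of_int_eq_iff by blast
  with n' assms have m': "m' \<noteq> 0" by auto
  have "multiplicity l (m * n') = multiplicity l m + multiplicity l n'"
    using l assms n' by (intro prime_elem_multiplicity_mult_distrib) auto
  moreover have "multiplicity l (m' * n) = multiplicity l m' + multiplicity l n"
    using l assms m' by (intro prime_elem_multiplicity_mult_distrib) auto
  ultimately have "multiplicity l m + multiplicity l n' = multiplicity l m' + multiplicity l n"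
    using eq by simp
  then show ?thesis by (simp add: rat_val_def q)
qed

lemma rat_val_of_int: "prime l \<Longrightarrow> m \<noteq> 0 \<Longrightarrow> rat_val l (of_int m) = int (multiplicity l m)"
  using rat_val_fraction[of l m 1] by simp

lemma rat_val_mult:
  assumes l: "prime l" and "x \<noteq> 0" "y \<noteq> 0"
  shows "rat_val l (x * y) = rat_val l x + rat_val l y"
proof -
  obtain m n where x: "x = of_int m / of_int n" "n > 0" by (rule rat_fraction_cases)
  obtain m' n' where y: "y = of_int m' / of_int n'" "n' > 0" by (rule rat_fraction_cases)
  have nz: "m \<noteq> 0" "m' \<noteq> 0" using x y assms by auto
  have "x * y = of_int (m * m') / of_int (n * n')" using x y by simp
  moreover have "multiplicity l (m * m') = multiplicity l m + multiplicity l m'"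
    "multiplicity l (n * n') = multiplicity l n + multiplicity l n'"
    using l nz x y by (auto intro!: prime_elem_multiplicity_mult_distrib)
  ultimately show ?thesis
    using l nz x y rat_val_fraction[OF l, of m n] rat_val_fraction[OF l, of m' n']
      rat_val_fraction[OF l, of "m * m'" "n * n'"] by simp
qed

lemma rat_val_one: "prime l \<Longrightarrow> rat_val l 1 = 0"
  using rat_val_of_int[of l 1] by simp

lemma rat_val_uminus: "rat_val l (- x) = rat_val l x"
proof -
  have "multiplicity l (- m) = multiplicity l m" for m :: int
    using multiplicity_times_unit_right[of "- 1" l m] by simp
  then show ?thesis
    by (cases "quotient_of x") (simp add: rat_val_def rat_uminus_code Let_def)
qed

lemma rat_val_power: "prime l \<Longrightarrow> x \<noteq> 0 \<Longrightarrow> rat_val l (x ^ k) = int k * rat_val l x"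
  by (induction k) (simp_all add: rat_val_one rat_val_mult algebra_simps)

lemma rat_val_add:
  assumes l: "prime l" and nz: "x \<noteq> 0" "y \<noteq> 0" "x + y \<noteq> 0"
  shows "rat_val l (x + y) \<ge> min (rat_val l x) (rat_val l y)"
proof -
  obtain m n where x: "x = of_int m / of_int n" "n > 0" by (rule rat_fraction_cases)
  obtain m' n' where y: "y = of_int m' / of_int n'" "n' > 0" by (rule rat_fraction_cases)
  define M where "M = m * n'"
  define M' where "M' = m' * n"
  define N where "N = n * n'"
  have N: "N \<noteq> 0" using x y by (simp add: N_def)
  have x': "x = of_int M / of_int N" and y': "y = of_int M' / of_int N"
    using x y by (simp_all add: M_def M'_def N_def)
  have s: "x + y = of_int (M + M') / of_int N" by (simp add: x' y' add_divide_distrib)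
  have nz': "M \<noteq> 0" "M' \<noteq> 0" "M + M' \<noteq> 0" using nz x' y' s by auto
  let ?k = "min (multiplicity l M) (multiplicity l M')"
  have "l ^ ?k dvd M" "l ^ ?k dvd M'"
    by (simp_all add: multiplicity_dvd')
  then have "l ^ ?k dvd M + M'" by simp
  then have "?k \<le> multiplicity l (M + M')"
    using l nz' by (intro multiplicity_geI) auto
  then show ?thesis
    using rat_val_fraction[OF l nz'(1) N] rat_val_fraction[OF l nz'(2) N]
      rat_val_fraction[OF l nz'(3) N] by (simp add: x' y' s[unfolded x' y'])
qed

lemma rat_val_add_less:
  assumes l: "prime l" and nz: "x \<noteq> 0" "y \<noteq> 0" and less: "rat_val l x < rat_val l y"
  shows "rat_val l (x + y) = rat_val l x"
proof -
  have s: "x + y \<noteq> 0"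
    using less rat_val_uminus[of l y] by (auto simp: add_eq_0_iff2)
  have "rat_val l (x + y) \<ge> rat_val l x" using rat_val_add[OF l nz s] less by simp
  \<comment> \<open>The reverse bound comes from writing x as (x + y) + (- y).\<close>
  moreover have "rat_val l x \<ge> min (rat_val l (x + y)) (rat_val l y)"
    using rat_val_add[OF l s, of "- y"] nz by (simp add: rat_val_uminus)
  ultimately show ?thesis using less by linarith
qed

lemma rat_val_zero_not_dvd:
  assumes l: "prime l" and "m \<noteq> 0" "n \<noteq> 0" "coprime m n"
    and v: "rat_val l (of_int m / of_int n) = 0"
  shows "\<not> l dvd m" "\<not> l dvd n"
proof -
  have eq: "multiplicity l m = multiplicity l n" using v rat_val_fraction[OF l assms(2,3)] by simp
  have "\<not> (l dvd m \<and> l dvd n)"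
    using assms(4) l by (meson coprime_common_divisor not_prime_unit)
  moreover have "l dvd m \<longleftrightarrow> l dvd n"
    using eq l assms by (metis multiplicity_eq_zero_iff not_prime_unit)
  ultimately show "\<not> l dvd m" "\<not> l dvd n" by auto
qed

text \<open>Here \<open>u n\<close> stands for a z^d. If v(u) > 0, then v(u + b) = 0, so the next
  value has the same valuation. If v(u) < 0, the next valuation is -(d - 1) v(u) > 0 and stays
  positive, which contradicts periodicity.\<close>

lemma cycle_rat_val:
  fixes u :: "nat \<Rightarrow> rat"
  assumes l: "prime l" and d: "d \<ge> 2" and b: "b \<noteq> 0" "rat_val l b = 0"
    and nz: "\<And>n. u n \<noteq> 0" "\<And>n. u n + b \<noteq> 0"
    and rec: "\<And>n. u n = u (Suc n) * (u n + b) ^ d"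
    and L: "L > 0" "\<And>n. u (n + L) = u n"
  shows "rat_val l (u n + b) = 0"
proof -
  let ?v = "rat_val l"
  have vrec: "?v (u n) = ?v (u (Suc n)) + int d * ?v (u n + b)" for n
    using arg_cong[OF rec, of ?v n] l nz by (simp add: rat_val_mult rat_val_power)
  have pos: "?v (u (Suc n)) > 0" if "?v (u n) > 0" for n
  proof -
    have "?v (b + u n) = 0" using rat_val_add_less[OF l b(1) nz(1)] that b by simp
    then show ?thesis using vrec[of n] that by (simp add: add.commute)
  qed
  have pos': "?v (u (n + k)) > 0" if "?v (u n) > 0" for n k
    using that by (induction k) (auto intro: pos)
  have nonneg: "?v (u n) \<ge> 0" for n
  proof (rule ccontr)
    assume neg: "\<not> ?v (u n) \<ge> 0"
    then have "?v (u n + b) = ?v (u n)" using rat_val_add_less[OF l nz(1) b(1)] b by simp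
    then have "?v (u (Suc n)) = - (int d - 1) * ?v (u n)" using vrec[of n] by (simp add: algebra_simps)
    then have "?v (u (Suc n)) > 0" using neg d by (simp only:) (rule mult_neg_neg; simp)
    from pos'[OF this, of "L - 1"] have "?v (u (n + L)) > 0" using L by simp
    then show False using neg L by simp
  qed
  show ?thesis
  proof (cases "?v (u n) = 0")
    case True
    \<comment> \<open>With v(u) = 0 the recursion gives v(u') = - d v(u + b), and both v(u') and v(u
      + b) are nonnegative.\<close>
    have "?v (u n + b) \<ge> 0" using rat_val_add[OF l nz(1) b(1) nz(2), of n] True b by simp
    moreover have "int d * ?v (u n + b) \<le> 0" using vrec[of n] True nonneg[of "Suc n"] by linarith
    ultimately show ?thesis using d by (simp add: mult_le_0_iff)
  next
    case False
    then have "?v (u n) > 0" using nonneg[of n] by simp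
    then show ?thesis using rat_val_add_less[OF l b(1) nz(1)] b by (simp add: add.commute)
  qed
qed

subsection \<open>Integrality and size estimates\<close>

text \<open>This is how the prime power condition on b enters: two non-units would each have a prime
  divisor, both equal to q, against coprimality.\<close>

lemma coprime_single_prime_unit:
  fixes m n q :: int
  assumes "coprime m n" "m \<noteq> 0" "n \<noteq> 0"
    and "\<And>l. prime l \<Longrightarrow> l dvd m \<or> l dvd n \<Longrightarrow> l = q"
  shows "\<bar>m\<bar> = 1 \<or> \<bar>n\<bar> = 1"
proof (rule ccontr)
  assume "\<not> ?thesis"
  then have "\<not> is_unit m" "\<not> is_unit n" by simp_all
  then obtain l l' where "prime l" "l dvd m" "prime l'" "l' dvd n"
    using assms(2,3) by (meson prime_divisor_exists)
  with assms(4) have "l dvd m" "l dvd n" "prime l" by blast+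
  with assms(1) show False by (meson coprime_common_divisor not_prime_unit)
qed

lemma Ints_abs_less_one_rat:
  fixes x :: rat
  assumes "x \<in> \<int>" "\<bar>x\<bar> < 1"
  shows "x = 0"
  using assms Ints_nonzero_abs_ge1 by force

lemma mult_abs_le_power2:
  fixes c w :: int
  assumes "c \<le> \<bar>w\<bar>"
  shows "c * \<bar>w\<bar> \<le> \<bar>w\<bar> ^ 2"
  unfolding power2_eq_square using assms by (rule mult_right_mono) simp

lemma step_of_large_not_integral:
  fixes w B :: int and t' :: rat
  assumes d: "d \<ge> 2" and B: "\<bar>B\<bar> \<ge> 2" and w: "\<bar>w\<bar> > \<bar>B\<bar>"
    and rec: "of_int w ^ d * (t' - of_int B) = of_int w - of_int B"
  shows "t' \<notin> \<int>" "inverse t' \<notin> \<int>"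
proof -
  \<comment> \<open>Since |w| >= 3, the bound |w - B| < 2|w| lies below |w|^2, hence below
    |w|^d.\<close>
  have "\<bar>w\<bar> ^ 2 \<le> \<bar>w\<bar> ^ d" using d B w by (intro power_increasing) auto
  moreover have "3 * \<bar>w\<bar> \<le> \<bar>w\<bar> ^ 2" using B w by (intro mult_abs_le_power2) simp
  ultimately have "\<bar>w - B\<bar> < \<bar>w\<bar> ^ d" using w B by linarith
  then have lt: "\<bar>of_int w - of_int B\<bar> < (\<bar>of_int w\<bar> ^ d :: rat)"
    by (metis of_int_abs of_int_diff of_int_less_iff of_int_power)
  have "\<bar>of_int w\<bar> ^ d * \<bar>t' - of_int B\<bar> = \<bar>of_int w - of_int B\<bar>"
    using arg_cong[OF rec, of abs] by (simp add: abs_mult power_abs)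
  with lt have "\<bar>of_int w\<bar> ^ d * \<bar>t' - of_int B\<bar> < \<bar>of_int w\<bar> ^ d * 1" by simp
  then have less: "\<bar>t' - of_int B\<bar> < 1"
    using w by (subst (asm) mult_less_cancel_left_pos) auto
  have "\<bar>of_int B\<bar> \<ge> (2 :: rat)" using B by (metis of_int_abs of_int_le_iff of_int_numeral)
  with less have gt: "\<bar>t'\<bar> > 1" by linarith
  show "t' \<notin> \<int>"
  proof
    assume "t' \<in> \<int>"
    then have "t' - of_int B = 0" using less by (intro Ints_abs_less_one_rat) auto
    with rec have "w = B" by simp
    with w show False by simp
  qed
  show "inverse t' \<notin> \<int>"
  proof
    assume "inverse t' \<in> \<int>"
    moreover have "\<bar>inverse t'\<bar> < 1" using gt by (simp add: abs_inverse inverse_less_1_iff)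
    ultimately have "inverse t' = 0" by (rule Ints_abs_less_one_rat)
    with gt show False by simp
  qed
qed

lemma step_of_small_large:
  fixes T B :: int and t' :: rat
  assumes d: "d \<ge> 2" and B: "\<bar>B\<bar> \<ge> 2" and T: "\<bar>T\<bar> \<ge> 2"
    and rec: "inverse (of_int T) ^ d * (t' - of_int B) = inverse (of_int T) - of_int B"
  obtains w where "t' = of_int w" "\<bar>w\<bar> > \<bar>B\<bar>"
proof -
  obtain k where k: "d = Suc k" "k \<ge> 1" using d by (cases d) auto
  \<comment> \<open>This is the recursion solved for t', with t = 1/T and d = k + 1. The bounds
    below give |w - B| >= 4|B| - 2, hence |w| >= 3|B| - 2 > |B|.\<close>
  define w where "w = T ^ k * (1 - B * T) + B"
  have "of_int T \<noteq> (0 :: rat)" using T by auto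
  then have "t' = of_int T ^ d * (inverse (of_int T) - of_int B) + of_int B"
    using rec by (simp add: field_simps)
  also have "\<dots> = of_int w"
    using \<open>of_int T \<noteq> (0 :: rat)\<close> by (simp add: w_def k field_simps)
  finally have t': "t' = of_int w" .
  have "2 * \<bar>B\<bar> \<le> \<bar>B * T\<bar>" using T by (simp add: abs_mult mult_left_mono mult.commute)
  then have 1: "2 * \<bar>B\<bar> - 1 \<le> \<bar>1 - B * T\<bar>" by linarith
  have "\<bar>T\<bar> ^ 1 \<le> \<bar>T\<bar> ^ k" using k T by (intro power_increasing) auto
  then have 2: "2 \<le> \<bar>T ^ k\<bar>" using T by (simp add: power_abs)
  have "2 * (2 * \<bar>B\<bar> - 1) \<le> \<bar>T ^ k\<bar> * \<bar>1 - B * T\<bar>"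
    using 1 2 B by (intro mult_mono) auto
  then have "\<bar>w - B\<bar> \<ge> 2 * (2 * \<bar>B\<bar> - 1)" by (simp add: w_def abs_mult)
  then have "\<bar>w\<bar> > \<bar>B\<bar>" using B by (smt (verit))
  with t' show ?thesis using that by blast
qed

lemma integral_orbit_abs_ge_one:
  fixes t :: "nat \<Rightarrow> rat" and B :: int
  assumes d: "d \<ge> 2" and B: "\<bar>B\<bar> \<ge> 2" and nz: "\<And>n. t n \<noteq> 0"
    and rec: "\<And>n. t n ^ d * (t (Suc n) - of_int B) = t n - of_int B"
    and int: "\<And>n. t n \<in> \<int> \<or> inverse (t n) \<in> \<int>"
  shows "\<bar>t n\<bar> \<ge> 1"
proof (rule ccontr)
  assume less: "\<not> \<bar>t n\<bar> \<ge> 1"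
  then have "t n \<notin> \<int>" using Ints_abs_less_one_rat[of "t n"] nz by auto
  then obtain T where T: "inverse (t n) = of_int T" using int[of n] by (auto elim: Ints_cases)
  then have tn: "t n = inverse (of_int T)" by (metis inverse_inverse_eq)
  have "\<bar>T\<bar> \<ge> 2"
  proof (rule ccontr)
    assume "\<not> \<bar>T\<bar> \<ge> 2"
    then have "T = 0 \<or> T = 1 \<or> T = -1" by linarith
    then show False using tn nz[of n] less by auto
  qed
  then obtain w where "t (Suc n) = of_int w" "\<bar>w\<bar> > \<bar>B\<bar>"
    using step_of_small_large[OF d B _ rec[of n, unfolded tn]] by blast
  then show False
    using step_of_large_not_integral[OF d B, of w "t (Suc (Suc n))"] rec[of "Suc n"] int[of "Suc (Suc n)"] by auto
qed

section \<open>Rational roots of the backward equations\<close>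

text \<open>The equation is u' t^d = t - b with u' = - b, so a root would be a second preimage of
  infinity. For t = m/n in lowest terms both m and n divide B, so one of them is a unit, and
  comparing sizes leaves only t = 1 and t = - 1.\<close>

lemma no_preimage_of_pole_preimage:
  fixes B q :: int and t :: rat
  assumes d: "d \<ge> 2" and B: "B \<noteq> 0" and Bq: "\<And>l. prime l \<Longrightarrow> l dvd B \<Longrightarrow> l = q"
  shows "of_int B * t ^ d + t - of_int B \<noteq> 0"
proof
  assume eq: "of_int B * t ^ d + t - of_int B = 0"
  obtain k where k: "d = Suc k" "k \<ge> 1" using d by (cases d) auto
  obtain m n where t: "t = of_int m / of_int n" and cop: "coprime m n" and n: "n > 0"
    by (rule rat_fraction_cases)
  have "of_int (B * m ^ d + m * n ^ k - B * n ^ d) = (of_int B * t ^ d + t - of_int B) * of_int n ^ d"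
    using n by (simp add: t k field_simps)
  also have "\<dots> = 0" using eq by simp
  finally have E: "B * m ^ d + m * n ^ k - B * n ^ d = 0" by (simp only: of_int_eq_0_iff)
  have m: "m \<noteq> 0" using E B n k by auto
  have "B * n ^ d = m * (B * m ^ k + n ^ k)" using E by (simp add: k algebra_simps)
  then have "m dvd B * n ^ d" by simp
  then have mB: "m dvd B" using cop by (simp add: coprime_dvd_mult_left_iff)
  have "n dvd n ^ k" using k by (simp add: dvd_power)
  then have "n dvd B * n ^ d - m * n ^ k" by (simp add: k)
  also have "B * n ^ d - m * n ^ k = B * m ^ d" using E by simp
  finally have nB: "n dvd B" using cop by (simp add: coprime_dvd_mult_left_iff coprime_commute)
  have "\<bar>m\<bar> = 1 \<or> \<bar>n\<bar> = 1"
    using Bq mB nB by (intro coprime_single_prime_unit[OF cop m]) (use n in \<open>auto dest: dvd_trans\<close>)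
  then consider "\<bar>m\<bar> = 1" "n = 1" | "\<bar>m\<bar> \<ge> 2" "n = 1" | "\<bar>m\<bar> = 1" "n \<ge> 2"
    using m n by linarith
  then show False
  proof cases
    case 1
    \<comment> \<open>For m = - 1 and odd d the equation reads - 2B - 1 = 0, which parity excludes;
      the other choices are immediate.\<close>
    then have "m = 1 \<or> m = -1" by linarith
    with 1 E show False by (cases "even d") (auto, presburger+)
  next
    case 2
    have "\<bar>m\<bar> ^ 2 \<le> \<bar>m\<bar> ^ d" using d 2 by (intro power_increasing) auto
    moreover have "2 * \<bar>m\<bar> \<le> \<bar>m\<bar> ^ 2" using 2 by (intro mult_abs_le_power2)
    moreover have "\<bar>m ^ d\<bar> = \<bar>m\<bar> ^ d" by (rule power_abs)
    ultimately have "\<bar>m\<bar> < \<bar>m ^ d - 1\<bar>" using 2 by linarith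
    also have "\<dots> \<le> \<bar>B\<bar> * \<bar>m ^ d - 1\<bar>" using B mult_right_mono[of 1 "\<bar>B\<bar>" "\<bar>m ^ d - 1\<bar>"] by simp
    also have "\<dots> = \<bar>m\<bar>" using E 2 by (simp add: abs_mult[symmetric] algebra_simps)
    finally show False by simp
  next
    case 3
    have "n ^ 1 \<le> n ^ k" using k 3 by (intro power_increasing) auto
    then have nk: "2 \<le> n ^ k" using 3 by simp
    have "\<bar>B\<bar> * 2 \<le> \<bar>B * n\<bar>" using 3 by (simp add: abs_mult mult_left_mono)
    then have "2 * \<bar>B\<bar> - 1 \<le> \<bar>B * n - m\<bar>" using 3 by linarith
    then have "2 * (2 * \<bar>B\<bar> - 1) \<le> n ^ k * \<bar>B * n - m\<bar>"
      using nk B by (intro mult_mono) auto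
    also have "\<dots> = \<bar>n ^ k * (B * n - m)\<bar>" using n by (simp add: abs_mult)
    also have "n ^ k * (B * n - m) = B * m ^ d" using E by (simp add: k algebra_simps)
    also have "\<bar>B * m ^ d\<bar> = \<bar>B\<bar>" using 3 by (simp add: abs_mult power_abs)
    finally show False using B by simp
  qed
qed

text \<open>For t = m/n in lowest terms, n^k divides 1 - B and m divides B. Writing 1 - B = n^k r
  and B = m c turns the equation into r m^k = 1 - c n, so m and c are coprime factors of B and one
  of them is a unit.\<close>

lemma preimage_of_fixed_point:
  fixes B q :: int and t :: rat
  assumes d: "d \<ge> 3" and B: "B \<noteq> 0" "B \<noteq> 1" and Bq: "\<And>l. prime l \<Longrightarrow> l dvd B \<Longrightarrow> l = q"
    and eq: "(1 - of_int B) * t ^ d = t - of_int B"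
  shows "t = 1"
proof -
  obtain k where k: "d = Suc k" "k \<ge> 2" using d by (cases d) auto
  obtain m n where t: "t = of_int m / of_int n" and cop: "coprime m n" and n: "n > 0"
    by (rule rat_fraction_cases)
  have "of_int ((1 - B) * m ^ d) = ((1 - of_int B) * t ^ d) * of_int n ^ d"
    using n by (simp add: t power_divide)
  also have "\<dots> = of_int (n ^ k * (m - B * n))"
    unfolding eq using n by (simp add: t k field_simps)
  finally have E: "(1 - B) * m ^ d = n ^ k * (m - B * n)" by (simp only: of_int_eq_iff)
  have "n ^ k dvd (1 - B) * m ^ d" by (simp add: E)
  then have "n ^ k dvd 1 - B" using cop by (simp add: coprime_dvd_mult_left_iff coprime_commute)
  then obtain r where r: "1 - B = n ^ k * r" by (elim dvdE)
  have r0: "r \<noteq> 0" using r B by auto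
  have "n ^ k * (r * m ^ d) = n ^ k * (m - B * n)" using E by (simp add: r mult.assoc)
  then have E2: "r * m ^ d = m - B * n" using n by simp
  have m: "m \<noteq> 0" using E2 B n k by auto
  have "B * n = m * (1 - r * m ^ k)" using E2 by (simp add: k algebra_simps)
  then have "m dvd B * n" by simp
  then have "m dvd B" using cop by (simp add: coprime_dvd_mult_left_iff)
  then obtain c where c: "B = m * c" by (elim dvdE)
  have c0: "c \<noteq> 0" using c B by auto
  have "m * (r * m ^ k) = m * (1 - c * n)" using E2 by (simp add: k c algebra_simps)
  then have E3: "r * m ^ k = 1 - c * n" using m by simp
  have "coprime m c"
  proof (rule coprimeI)
    fix x assume x: "x dvd m" "x dvd c"
    have "m dvd m ^ k" using k by (simp add: dvd_power)
    with x have "x dvd r * m ^ k + c * n" by (meson dvd_add dvd_mult dvd_mult2 dvd_trans)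
    then show "is_unit x" by (simp add: E3)
  qed
  then have mc: "\<bar>m\<bar> = 1 \<or> \<bar>c\<bar> = 1"
    using Bq m c0 by (intro coprime_single_prime_unit[of m c q]) (auto simp: c)
  have absB: "\<bar>B\<bar> = \<bar>m\<bar> * \<bar>c\<bar>" by (simp add: c abs_mult)
  have abs_r: "\<bar>r\<bar> * n ^ k = \<bar>1 - B\<bar>" using n by (simp add: r abs_mult)
  have nk: "n ^ 2 \<le> n ^ k" using n k by (intro power_increasing) auto
  \<comment> \<open>Otherwise |c| = 1 and |m| = |B|, and the relations r m^k = 1 - c n and r n^k = 1
    - B give m^2 <= 1 + n and n^2 <= 1 + |m|. Both use k >= 2, that is d >= 3.\<close>
  have m1: "\<bar>m\<bar> = 1"
  proof (rule ccontr)
    assume m1: "\<bar>m\<bar> \<noteq> 1"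
    with mc absB m have c1: "\<bar>c\<bar> = 1" "\<bar>B\<bar> = \<bar>m\<bar>" "\<bar>m\<bar> \<ge> 2" by auto
    have "\<bar>m\<bar> ^ 2 \<le> \<bar>m\<bar> ^ k" using c1 k by (intro power_increasing) auto
    also have "\<dots> \<le> \<bar>r\<bar> * \<bar>m\<bar> ^ k" using r0 mult_right_mono[of 1 "\<bar>r\<bar>" "\<bar>m\<bar> ^ k"] by simp
    also have "\<dots> = \<bar>1 - c * n\<bar>" by (simp add: E3[symmetric] abs_mult power_abs)
    also have "\<dots> \<le> 1 + \<bar>c * n\<bar>" by linarith
    also have "\<dots> = 1 + n" using c1 n by (simp add: abs_mult)
    finally have 1: "\<bar>m\<bar> ^ 2 \<le> 1 + n" .
    have "n ^ 2 \<le> \<bar>r\<bar> * n ^ k" using nk r0 n by (smt (verit) mult_le_cancel_right1 zero_less_power)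
    then have 2: "n ^ 2 \<le> 1 + \<bar>m\<bar>" using abs_r c1 by linarith
    have 3: "2 * \<bar>m\<bar> \<le> \<bar>m\<bar> ^ 2" using c1 by (intro mult_abs_le_power2)
    with 1 c1 have "n \<ge> 3" by linarith
    then have "3 * n \<le> n ^ 2" by (simp add: power2_eq_square mult_right_mono)
    with 1 2 3 c1 show False by linarith
  qed
  \<comment> \<open>Now |c| = |B|, so |r| = |1 - c n| >= 2|B| - 1 for n >= 2, which is too large for
    |r| n^k = |1 - B|.\<close>
  have n1: "n = 1"
  proof (rule ccontr)
    assume "n \<noteq> 1"
    with n have n2: "n \<ge> 2" by simp
    have cB: "\<bar>c\<bar> = \<bar>B\<bar>" using absB m1 by simp
    have "\<bar>B\<bar> * 2 \<le> \<bar>c * n\<bar>" using n2 cB by (simp add: abs_mult mult_left_mono)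
    moreover have "\<bar>r\<bar> = \<bar>1 - c * n\<bar>" using m1 by (simp add: E3[symmetric] abs_mult power_abs)
    ultimately have "2 * \<bar>B\<bar> - 1 \<le> \<bar>r\<bar>" by linarith
    moreover have "2 * 2 \<le> n ^ 2" unfolding power2_eq_square using n2 by (intro mult_mono) auto
    ultimately have "(2 * \<bar>B\<bar> - 1) * 4 \<le> \<bar>r\<bar> * n ^ k" using nk B by (intro mult_mono) auto
    then show False unfolding abs_r using B by (smt (verit))
  qed
  show "t = 1"
  proof (rule ccontr)
    assume "t \<noteq> 1"
    then have "m = -1" using m1 n1 t by (auto simp: abs_if split: if_splits)
    with E n1 B show False by (cases "even d") auto
  qed
qed

section \<open>Integers that are not squares\<close>

lemma rat_square_eq_int:
  fixes x :: rat
  assumes "x ^ 2 = of_int D"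
  obtains y where "D = y ^ 2"
proof -
  obtain m n where x: "x = of_int m / of_int n" and cop: "coprime m n" and n: "n > 0"
    by (rule rat_fraction_cases)
  have "of_int (m ^ 2) = (of_int (D * n ^ 2) :: rat)"
    using assms n by (simp add: x field_simps)
  then have E: "m ^ 2 = D * n ^ 2" by (simp only: of_int_eq_iff)
  then have "n ^ 2 dvd m ^ 2" by simp
  then have "n dvd m" by (simp add: pow_divides_pow_iff)
  with cop have "is_unit n" by (metis coprime_absorb_right)
  with n have "n = 1" by simp
  with E show ?thesis using that[of m] by simp
qed

lemma not_square_between:
  fixes M y :: int
  assumes "M \<ge> 0" "M ^ 2 < y ^ 2" "y ^ 2 < (M + 1) ^ 2"
  shows False
proof -
  have "M < \<bar>y\<bar>" using assms power2_less_imp_less[of M "\<bar>y\<bar>"] by simp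
  moreover have "\<bar>y\<bar> < M + 1" using assms power2_less_imp_less[of "\<bar>y\<bar>" "M + 1"] by simp
  ultimately show False by simp
qed

text \<open>The number lies strictly between (B - 1)^2 and B^2 for B >= 2, and between B^2 and (1 -
  B)^2 for B < 0.\<close>

lemma square_minus_self_not_square:
  fixes B y :: int
  assumes "B \<noteq> 0" "B \<noteq> 1"
  shows "B ^ 2 - B \<noteq> y ^ 2"
proof
  assume y: "B ^ 2 - B = y ^ 2"
  show False
  proof (cases "B > 0")
    case True
    moreover have "(B - 1) ^ 2 = B ^ 2 - 2 * B + 1" by (simp add: power2_eq_square algebra_simps)
    ultimately show False using not_square_between[of "B - 1" y] y assms by simp
  next
    case False
    moreover have "(- B + 1) ^ 2 = B ^ 2 - 2 * B + 1" by (simp add: power2_eq_square algebra_simps)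
    ultimately show False using not_square_between[of "- B" y] y assms by simp
  qed
qed

lemma square_minus_one_not_square:
  fixes B y :: int
  assumes "B \<noteq> 0" "\<bar>B\<bar> \<noteq> 1"
  shows "B ^ 2 - 1 \<noteq> y ^ 2"
proof
  assume y: "B ^ 2 - 1 = y ^ 2"
  have "\<bar>B\<bar> \<ge> 2" using assms by linarith
  moreover have "(\<bar>B\<bar> - 1) ^ 2 = B ^ 2 - 2 * \<bar>B\<bar> + 1" by (simp add: power2_eq_square algebra_simps)
  moreover have "(\<bar>B\<bar> - 1 + 1) ^ 2 = B ^ 2" by simp
  ultimately show False using y by (intro not_square_between[of "\<bar>B\<bar> - 1" y]) linarith+
qed

text \<open>This ends the backward orbit for d = 2: it is u' t^2 = t - b with u' (1 - b) = b^2. The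
  discriminant (2 B^2 - B)^2 - 2 B + 1 lies strictly between consecutive squares, so there is no
  rational root.\<close>

lemma quadratic_second_preimage:
  fixes B :: int and t :: rat
  assumes B: "B \<noteq> 0" "B \<noteq> 1"
  shows "of_int B ^ 2 * t ^ 2 \<noteq> (1 - of_int B) * (t - of_int B)"
proof
  assume eq: "of_int B ^ 2 * t ^ 2 = (1 - of_int B) * (t - of_int B)"
  have "(2 * of_int B ^ 2 * t - (1 - of_int B)) ^ 2 =
      4 * of_int B ^ 2 * (of_int B ^ 2 * t ^ 2) - 4 * of_int B ^ 2 * t * (1 - of_int B) + (1 - of_int B) ^ 2"
    by algebra
  also have "\<dots> = of_int ((2 * B ^ 2 - B) ^ 2 - 2 * B + 1)"
    unfolding eq by simp algebra
  finally obtain y where y: "(2 * B ^ 2 - B) ^ 2 - 2 * B + 1 = y ^ 2"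
    by (rule rat_square_eq_int)
  define M where "M = 2 * B ^ 2 - B"
  have sq: "(M - 1) ^ 2 = M ^ 2 - 2 * M + 1" "(M + 1) ^ 2 = M ^ 2 + 2 * M + 1"
    by (simp_all add: power2_eq_square algebra_simps)
  have y': "y ^ 2 = M ^ 2 - 2 * B + 1" using y by (simp add: M_def)
  show False
  proof (cases "B > 0")
    case True
    with B have "B \<ge> 2" by simp
    then have "2 * B \<le> B ^ 2" by (simp add: power2_eq_square mult_right_mono)
    then show False using \<open>B \<ge> 2\<close> sq y' M_def by (intro not_square_between[of "M - 1" y]) simp_all
  next
    case False
    have "B ^ 2 > 0" using B by simp
    then show False using False B sq y' M_def by (intro not_square_between[of M y]) linarith+
  qed
qed

subsection \<open>Preperiodic points\<close>

lemma cycle_denominator_unit: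
  fixes z :: "nat \<Rightarrow> rat" and B q :: int
  assumes d: "d \<ge> 2" and a: "a \<noteq> 0" and B: "B \<noteq> 0"
    and Bq: "\<And>l. prime l \<Longrightarrow> l dvd B \<Longrightarrow> l = q"
    and nz: "\<And>n. z n \<noteq> 0" "\<And>n. a * z n ^ d + of_int B \<noteq> 0"
    and rec: "\<And>n. z (Suc n) = z n / (a * z n ^ d + of_int B)"
    and L: "L > 0" "\<And>n. z (n + L) = z n"
  shows "a * z n ^ d + of_int B = 1 \<or> even d \<and> a * z n ^ d + of_int B = - 1"
proof -
  define t where "t n = a * z n ^ d + of_int B" for n
  have t0: "t n \<noteq> 0" for n using nz by (simp add: t_def)
  have zrec: "z n = z (Suc n) * t n" for n using rec[of n] t0[of n] by (simp add: t_def)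
  have urec: "a * z n ^ d = (a * z (Suc n) ^ d) * t n ^ d" for n
    using zrec[of n] by (metis mult.assoc power_mult_distrib)
  have trec: "t n ^ d * (t (Suc n) - of_int B) = t n - of_int B" for n
    using urec[of n, symmetric] by (simp add: t_def mult.commute)
  have val: "rat_val l (t n) = 0" if l: "prime l" "\<not> l dvd B" for l n
  proof -
    have vB: "rat_val l (of_int B) = 0"
      using l B by (simp add: rat_val_of_int not_dvd_imp_multiplicity_0)
    show ?thesis unfolding t_def
      by (rule cycle_rat_val[where u = "\<lambda>n. a * z n ^ d", OF l(1) d _ vB _ nz(2) urec[unfolded t_def] L(1)])
        (use B a nz(1) L(2) in simp_all)
  qed
  \<comment> \<open>The case |B| = 1 is separate because the size estimates need |B| >= 2; no prime
    divides B then, so t is already 1 or - 1.\<close>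
  have int: "\<exists>m k. t n = of_int m / of_int k \<and> (if \<bar>B\<bar> = 1 then \<bar>m\<bar> = 1 \<and> k = 1 else \<bar>m\<bar> = 1 \<or> k = 1)" for n
  proof -
    obtain m k where t: "t n = of_int m / of_int k" and cop: "coprime m k" and k: "k > 0"
      by (rule rat_fraction_cases)
    have m: "m \<noteq> 0" using t t0[of n] by auto
    have dvdB: "l dvd B" if "prime l" "l dvd m \<or> l dvd k" for l
      using val[OF that(1), of n] rat_val_zero_not_dvd[OF that(1) m _ cop] k that(2) t by auto
    show ?thesis
    proof (cases "\<bar>B\<bar> = 1")
      case True
      then have "is_unit B" by simp
      then have "is_unit m \<and> is_unit k"
        using dvdB m k by (metis dvd_trans less_irrefl not_prime_unit prime_divisor_exists)
      then show ?thesis using True t k by auto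
    next
      case False
      have "\<bar>m\<bar> = 1 \<or> \<bar>k\<bar> = 1"
        using m k dvdB Bq by (intro coprime_single_prime_unit[OF cop, of q]) auto
      then show ?thesis using False t k by auto
    qed
  qed
  have ge1: "\<bar>t n\<bar> \<ge> 1" for n
  proof (cases "\<bar>B\<bar> = 1")
    case True
    with int[of n] obtain m where "t n = of_int m" "\<bar>m\<bar> = 1" by auto
    then show ?thesis by (auto simp: abs_if split: if_splits)
  next
    case False
    with B have B2: "\<bar>B\<bar> \<ge> 2" by linarith
    have "t n \<in> \<int> \<or> inverse (t n) \<in> \<int>" for n
    proof -
      obtain m k where t: "t n = of_int m / of_int k" "\<bar>m\<bar> = 1 \<or> k = 1" using int[of n] False by auto
      then have "m = 1 \<or> m = - 1 \<or> k = 1" by linarith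
      then show ?thesis using t(1) by auto
    qed
    then show ?thesis using integral_orbit_abs_ge_one[of d B t, OF d B2 t0 trec] by blast
  qed
  have mono: "\<bar>z (n + k)\<bar> \<le> \<bar>z n\<bar>" for n k
  proof (induction k)
    case (Suc k)
    have "\<bar>z (Suc (n + k))\<bar> * 1 \<le> \<bar>z (Suc (n + k))\<bar> * \<bar>t (n + k)\<bar>"
      using ge1 by (intro mult_left_mono) auto
    also have "\<dots> = \<bar>z (n + k)\<bar>" by (simp only: abs_mult[symmetric] zrec[of "n + k", symmetric])
    finally show ?case using Suc by simp
  qed simp
  \<comment> \<open>By \<open>mono\<close> the absolute value of z never increases, and it returns
    after L steps, so it is constant on the cycle.\<close>
  have abs1: "\<bar>t n\<bar> = 1" for n
  proof -
    have "\<bar>z (Suc n)\<bar> * \<bar>t n\<bar> = \<bar>z n\<bar>" by (simp only: abs_mult[symmetric] zrec[of n, symmetric])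
    also have "\<dots> = \<bar>z (Suc n + (L - 1))\<bar>" using L by simp
    also have "\<dots> \<le> \<bar>z (Suc n)\<bar>" by (rule mono)
    finally have "\<bar>t n\<bar> \<le> 1" using nz(1)[of "Suc n"] by simp
    with ge1[of n] show ?thesis by linarith
  qed
  \<comment> \<open>For odd d, t = - 1 gives t' = 1 + 2B. Then |t'| = 1 leaves only B = - 1, which
    makes a z^d = t - B vanish.\<close>
  have "even d" if "t n = - 1"
  proof (rule ccontr)
    assume "odd d"
    then have "t (Suc n) = 1 + 2 * of_int B" using trec[of n] that by simp
    then have "(1 + 2 * of_int B :: rat) = 1 \<or> (1 + 2 * of_int B :: rat) = - 1"
      using abs1[of "Suc n"] by linarith
    then have "(of_int B :: rat) = 0 \<or> (of_int B :: rat) = - 1" by linarith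
    then have "(of_int B :: rat) = - 1" using B by simp
    then show False using that a nz(1)[of n] by (simp add: t_def)
  qed
  with abs1[of n] show ?thesis unfolding t_def by linarith
qed

text \<open>The possible values of \<open>u = a z^d\<close> at a preperiodic point \<open>z \<noteq> 0\<close>: \<open>z\<close> is mapped to
  infinity, is fixed, is mapped to \<open>- z\<close>, or (for \<open>d = 2\<close>) is the second preimage of a point of the
  last two kinds.\<close>

definition exceptional_value :: "nat \<Rightarrow> rat \<Rightarrow> rat \<Rightarrow> bool" where
  "exceptional_value d b u \<longleftrightarrow> u \<noteq> 0 \<and>
     (u = - b \<or> u = 1 - b \<or> even d \<and> u = - 1 - b \<or>
      d = 2 \<and> (u * (1 - b) = b ^ 2 \<or> u * (1 + b) = - (b ^ 2)))"

lemma preimage_of_fixed_point_cases: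
  fixes B q :: int and t :: rat
  assumes d: "d \<ge> 2" and B: "B \<noteq> 0" "B \<noteq> 1" and Bq: "\<And>l. prime l \<Longrightarrow> l dvd B \<Longrightarrow> l = q"
    and eq: "(1 - of_int B) * t ^ d = t - of_int B"
  shows "t = 1 \<or> d = 2 \<and> (1 - of_int B) * t = of_int B"
proof (cases "d = 2")
  case True
  \<comment> \<open>For d = 2 the equation is quadratic and the root t = 1 splits off; the other
    root is b / (1 - b).\<close>
  have "(t - 1) * ((1 - of_int B) * t - of_int B) = 0" using eq unfolding True by algebra
  then show ?thesis using True by auto
next
  case False
  then show ?thesis using preimage_of_fixed_point[OF _ B Bq eq] d by simp
qed

text \<open>One step back along an orbit: t - b is the value a z^d at a point and u' the value at
  its image, while t different from B means that the point is not 0.\<close>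

lemma exceptional_value_backward:
  fixes B q :: int and t u' :: rat
  assumes d: "d \<ge> 2" and B: "B \<noteq> 0" and Bq: "\<And>l. prime l \<Longrightarrow> l dvd B \<Longrightarrow> l = q"
    and t: "t \<noteq> of_int B" and eq: "u' * t ^ d = t - of_int B"
    and u': "exceptional_value d (of_int B) u'"
  shows "exceptional_value d (of_int B) (t - of_int B)"
proof -
  define b :: rat where "b = of_int B"
  have b0: "b \<noteq> 0" and tb: "t \<noteq> b" using B t by (simp_all add: b_def)
  have eq: "u' * t ^ d = t - b" using eq by (simp add: b_def)
  have Bq': "l = q" if "prime l" "l dvd - B" for l using Bq that by simp
  have "u' \<noteq> 0" using u' by (simp add: exceptional_value_def)
  from u' consider "u' = - b" | "u' = 1 - b" | "even d" "u' = - 1 - b"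
    | "d = 2" "u' * (1 - b) = b ^ 2" | "d = 2" "u' * (1 + b) = - (b ^ 2)"
    by (auto simp: exceptional_value_def b_def)
  then have "exceptional_value d b (t - b)"
  proof cases
    case 1
    then show ?thesis using no_preimage_of_pole_preimage[OF d B Bq, of t] eq by (simp add: b_def)
  next
    case 2
    then have "B \<noteq> 1" using \<open>u' \<noteq> 0\<close> by (auto simp: b_def)
    then have "t = 1 \<or> d = 2 \<and> (1 - b) * t = b"
      using preimage_of_fixed_point_cases[OF d B _ Bq, of t] eq 2 by (simp add: b_def)
    moreover have "(t - b) * (1 - b) = b ^ 2" if "(1 - b) * t = b"
      using that by (simp add: power2_eq_square algebra_simps)
    ultimately show ?thesis using tb by (auto simp: exceptional_value_def)
  next
    \<comment> \<open>For even \<open>d\<close> the substitution \<open>(b, t) \<mapsto> (- b, - t)\<close> exchanges the cases \<open>t' = 1\<close> and \<open>t' = - 1\<close>.\<close>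
    case 3
    then have B1: "- B \<noteq> 1" using \<open>u' \<noteq> 0\<close> by (auto simp: b_def)
    have "(1 - of_int (- B)) * (- t) ^ d = (- t) - of_int (- B)"
      using eq 3 by (simp add: b_def algebra_simps)
    then have "- t = 1 \<or> d = 2 \<and> (1 + b) * t = b"
      using preimage_of_fixed_point_cases[OF d _ B1 Bq', of "- t"] B by (simp add: b_def)
    moreover have "t = - 1" if "- t = 1" using that by simp
    moreover have "(t - b) * (1 + b) = - (b ^ 2)" if "(1 + b) * t = b"
      using that by (simp add: power2_eq_square algebra_simps)
    ultimately show ?thesis using tb 3 by (auto simp: exceptional_value_def)
  next
    case 4
    have "B \<noteq> 1" using 4 b0 by (auto simp: b_def)
    moreover have "b ^ 2 * t ^ 2 = (1 - b) * (t - b)"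
      unfolding 4(2)[symmetric] eq[symmetric] by (simp add: 4(1))
    ultimately show ?thesis using quadratic_second_preimage[OF B] by (simp add: b_def)
  next
    \<comment> \<open>Changing the signs of b and t reduces this to the quadratic of the preceding
      case.\<close>
    case 5
    have "- B \<noteq> 1" using 5 b0 by (auto simp: b_def)
    moreover have "b ^ 2 * (- t) ^ 2 = (1 + b) * (- t + b)"
    proof -
      have "b ^ 2 = - (u' * (1 + b))" using 5(2) by simp
      moreover have "- t + b = - (u' * t ^ 2)" using eq 5(1) by simp
      ultimately show ?thesis by simp
    qed
    ultimately show ?thesis using quadratic_second_preimage[of "- B" "- t"] B by (simp add: b_def)
  qed
  then show ?thesis by (simp add: b_def)
qed

section \<open>Fibres of a z^d and square classes\<close>

lemma card_power_fibre_le_2: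
  fixes a c :: rat
  assumes "d \<ge> 1" "a \<noteq> 0"
  shows "finite {z. a * z ^ d = c} \<and> card {z. a * z ^ d = c} \<le> 2"
proof (cases "\<exists>y. a * y ^ d = c")
  case True
  then obtain y where y: "a * y ^ d = c" by blast
  have sub: "{z. a * z ^ d = c} \<subseteq> {y, - y}"
  proof
    fix z assume "z \<in> {z. a * z ^ d = c}"
    then have "z ^ d = y ^ d" using y assms by auto
    then have "\<bar>z\<bar> ^ d = \<bar>y\<bar> ^ d" by (simp flip: power_abs)
    then have "\<bar>z\<bar> = \<bar>y\<bar>" using assms by (subst (asm) power_eq_iff_eq_base) auto
    then show "z \<in> {y, - y}" by (auto simp: abs_eq_iff)
  qed
  have "card {z. a * z ^ d = c} \<le> card {y, - y}" using sub by (intro card_mono) auto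
  also have "\<dots> \<le> 2" by (simp add: card_insert_if)
  finally show ?thesis using sub finite_subset by blast
qed simp

text \<open>The product is (x y / a)^2, and an integer that is a rational square is an integer
  square. This compares square classes without knowing a.\<close>

lemma rat_square_ratio:
  fixes a x y :: rat and M N :: int
  assumes "a \<noteq> 0" "a * of_int M = x ^ 2" "a * of_int N = y ^ 2"
  obtains k where "M * N = k ^ 2"
proof -
  have "of_int (M * N) * a ^ 2 = (x * y) ^ 2"
    unfolding power_mult_distrib assms(2,3)[symmetric] by (simp add: power2_eq_square)
  then have "(x * y / a) ^ 2 = of_int (M * N)"
    using assms(1) by (simp add: power_divide field_simps)
  then show ?thesis using that by (rule rat_square_eq_int)
qed

lemma exceptional_values_two:
  fixes a :: rat and B :: int
  assumes a: "a \<noteq> 0" and B: "B \<noteq> 0"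
  obtains c1 c2 where "\<And>z. exceptional_value d (of_int B) (a * z ^ d) \<Longrightarrow> a * z ^ d = c1 \<or> a * z ^ d = c2"
proof (cases "even d")
  case False
  \<comment> \<open>For odd d every other alternative in \<open>exceptional_value\<close> drops
    out.\<close>
  then have "d \<noteq> 2" by auto
  with False show ?thesis using that[of "- of_int B" "1 - of_int B"] by (auto simp: exceptional_value_def)
next
  case True
  define b :: rat where "b = of_int B"
  have b0: "b \<noteq> 0" using B by (simp add: b_def)
  \<comment> \<open>The exceptional values lie in the square classes of \<open>- b\<close>, \<open>1 - b\<close> and \<open>- 1 - b\<close>, and only one
    of these can contain the numbers \<open>a z^d\<close>.\<close>
  define S where "S M \<longleftrightarrow> M \<noteq> 0 \<and> (\<exists>x. a * of_int M = x ^ 2)" for M :: int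
  have prod: False if "S M" "S N" "\<And>k. M * N \<noteq> k ^ 2" for M N
    using that a unfolding S_def by (meson rat_square_ratio)
  have S12: "\<not> (S (- B) \<and> S (1 - B))"
  proof
    assume "S (- B) \<and> S (1 - B)"
    moreover have "B \<noteq> 1" using calculation by (auto simp: S_def)
    then have "- B * (1 - B) \<noteq> k ^ 2" for k
      using square_minus_self_not_square[of B k] B by (simp add: power2_eq_square algebra_simps)
    ultimately show False using prod by blast
  qed
  have S13: "\<not> (S (- B) \<and> S (- 1 - B))"
  proof
    assume "S (- B) \<and> S (- 1 - B)"
    moreover have "- B \<noteq> 1" using calculation by (auto simp: S_def)
    then have "- B * (- 1 - B) \<noteq> k ^ 2" for k
      using square_minus_self_not_square[of "- B" k] B by (simp add: power2_eq_square algebra_simps)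
    ultimately show False using prod by blast
  qed
  have S23: "\<not> (S (1 - B) \<and> S (- 1 - B))"
  proof
    assume "S (1 - B) \<and> S (- 1 - B)"
    moreover have "\<bar>B\<bar> \<noteq> 1" using calculation by (auto simp: S_def)
    then have "(1 - B) * (- 1 - B) \<noteq> k ^ 2" for k
      using square_minus_one_not_square[of B k] B by (simp add: power2_eq_square algebra_simps)
    ultimately show False using prod by blast
  qed
  \<comment> \<open>For even d the factor z^d is a square, so the square class of a z^d is that of a
    and does not depend on z.\<close>
  have SI: "S M" if "a * z ^ d * of_int M = y ^ 2" "y \<noteq> 0" for M z y
  proof -
    obtain h where h: "d = 2 * h" using True by (elim evenE)
    have zd: "z ^ d = (z ^ h) ^ 2" by (simp add: h mult.commute flip: power_mult)
    have "z ^ h \<noteq> 0"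
    proof
      assume "z ^ h = 0"
      then have "y ^ 2 = 0" using that(1) by (simp only: zd) simp
      with that(2) show False by simp
    qed
    then have "a * of_int M = (y / z ^ h) ^ 2" using that(1) by (simp add: zd power_divide field_simps)
    then show ?thesis using that unfolding S_def by auto
  qed
  \<comment> \<open>The second preimage b^2 / (1 - b) shares the class of 1 - b, and - b^2 / (1 + b)
    that of - 1 - b; so no class holds more than two values.\<close>
  have cases: "S (- B) \<and> a * z ^ d = - b \<or>
      S (1 - B) \<and> (a * z ^ d = 1 - b \<or> a * z ^ d = b ^ 2 / (1 - b)) \<or>
      S (- 1 - B) \<and> (a * z ^ d = - 1 - b \<or> a * z ^ d = - (b ^ 2) / (1 + b))"
    if ex: "exceptional_value d b (a * z ^ d)" for z
  proof -
    have u0: "a * z ^ d \<noteq> 0" using ex by (simp add: exceptional_value_def)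
    from ex consider "a * z ^ d = - b" | "a * z ^ d = 1 - b" | "a * z ^ d = - 1 - b"
      | "a * z ^ d * (1 - b) = b ^ 2" | "a * z ^ d * (1 + b) = - (b ^ 2)"
      by (auto simp: exceptional_value_def)
    then show ?thesis
    proof cases
      case 1
      then have "S (- B)" using SI[of z "- B" b] b0 by (simp add: b_def power2_eq_square)
      with 1 show ?thesis by blast
    next
      case 2
      then have "S (1 - B)" using SI[of z "1 - B" "1 - b"] u0 by (simp add: b_def power2_eq_square)
      with 2 show ?thesis by blast
    next
      case 3
      then have "S (- 1 - B)" using SI[of z "- 1 - B" "- 1 - b"] u0 by (simp add: b_def power2_eq_square)
      with 3 show ?thesis by blast
    next
      case 4
      then have "S (1 - B)" using SI[of z "1 - B" b] b0 by (simp add: b_def)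
      moreover have "a * z ^ d = b ^ 2 / (1 - b)"
        using 4 b0 by (metis mult_zero_right nonzero_mult_div_cancel_right power_not_zero)
      ultimately show ?thesis by blast
    next
      case 5
      have "a * z ^ d * of_int (- 1 - B) = - (a * z ^ d * (1 + b))" by (simp add: b_def algebra_simps)
      then have "S (- 1 - B)" using SI[of z "- 1 - B" b] b0 5 by simp
      moreover have "a * z ^ d = - (b ^ 2) / (1 + b)"
        using 5 b0 by (metis mult_zero_right neg_equal_0_iff_equal nonzero_mult_div_cancel_right power_not_zero)
      ultimately show ?thesis by blast
    qed
  qed
  consider "S (1 - B)" | "S (- 1 - B)" | "\<not> S (1 - B)" "\<not> S (- 1 - B)" by blast
  then show ?thesis
  proof cases
    case 1
    then show ?thesis using that[of "1 - b" "b ^ 2 / (1 - b)"] cases S12 S23 unfolding b_def by blast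
  next
    case 2
    then show ?thesis using that[of "- 1 - b" "- (b ^ 2) / (1 + b)"] cases S13 S23 unfolding b_def by blast
  next
    case 3
    then show ?thesis using that[of "- b" "- b"] cases unfolding b_def by blast
  qed
qed

section \<open>Rational points and their orbits\<close>

lemma affine_pt_inj: "inj (affine_pt :: 'a::field \<Rightarrow> 'a proj_line)"
proof (rule injI)
  fix x y :: 'a assume "affine_pt x = affine_pt y"
  then show "x = y" by transfer (auto simp: proj_rel_def)
qed

lemma proj_line_cases:
  fixes P :: "'a::field proj_line"
  obtains "P = infinity_pt" | z where "P = affine_pt z"
proof -
  have "P = infinity_pt \<or> (\<exists>z. P = affine_pt z)"
  proof (transfer)
    fix P :: "'a \<times> 'a" assume P: "proj_rel P P"
    obtain X Y where XY: "P = (X, Y)" by (cases P)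
    show "proj_rel P (1, 0) \<or> (\<exists>z. proj_rel P (z, 1))"
    proof (cases "Y = 0")
      case True
      then have "proj_rel P (1, 0)" using P XY
        by (auto simp: proj_rel_def intro!: exI[of _ "inverse X"])
      then show ?thesis ..
    next
      case False
      then have "proj_rel P (X / Y, 1)" using XY
        by (auto simp: proj_rel_def divide_inverse intro!: exI[of _ "inverse Y"])
      then show ?thesis by blast
    qed
  qed
  then show ?thesis using that by blast
qed

text \<open>The orbit is followed forward until it meets its first pole or, if there is none, a
  cycle. The value there is exceptional, and this property is carried back to the starting
  point.\<close>

lemma preperiodic_exceptional:
  fixes a z :: rat and B q :: int
  assumes d: "d \<ge> 2" and a: "a \<noteq> 0" and B: "B \<noteq> 0"
    and Bq: "\<And>l. prime l \<Longrightarrow> l dvd B \<Longrightarrow> l = q"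
    and P: "affine_pt z \<in> PrePer (psi d a (of_int B))" and z: "z \<noteq> 0"
  shows "exceptional_value d (of_int B) (a * z ^ d)"
proof -
  define b :: rat where "b = of_int B"
  have b0: "b \<noteq> 0" using B by (simp add: b_def)
  \<comment> \<open>\<open>F\<close> sends a pole to 0 by the convention for division by 0, so it only describes the orbit up
    to its first pole.\<close>
  define F where "F x = x / (a * x ^ d + b)" for x
  define zs where "zs n = (F ^^ n) z" for n
  have zs_Suc: "zs (Suc n) = zs n / (a * zs n ^ d + b)" for n by (simp add: zs_def F_def)
  have nz: "zs n \<noteq> 0" if "\<And>i. i < n \<Longrightarrow> a * zs i ^ d + b \<noteq> 0" for n
    using that
  proof (induction n)
    case (Suc n)
    then show ?case by (simp add: zs_Suc)
  qed (simp add: zs_def z)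
  have backward: "exceptional_value d b (a * zs 0 ^ d)"
    if "exceptional_value d b (a * zs n ^ d)" "\<And>i. i < n \<Longrightarrow> a * zs i ^ d + b \<noteq> 0" for n
    using that
  proof (induction n)
    case (Suc n)
    let ?t = "a * zs n ^ d + b"
    have t0: "?t \<noteq> 0" using Suc.prems by simp
    have "zs n \<noteq> 0" using nz Suc.prems by simp
    then have "?t \<noteq> of_int B" using a by (simp add: b_def)
    moreover have "a * zs (Suc n) ^ d * ?t ^ d = ?t - of_int B"
      using t0 by (simp add: zs_Suc power_divide b_def)
    ultimately have "exceptional_value d (of_int B) (?t - of_int B)"
      using exceptional_value_backward[OF d B Bq] Suc.prems(1) unfolding b_def by blast
    then show ?case using Suc.IH Suc.prems(2) by (simp add: b_def)
  qed
  have "\<exists>n. exceptional_value d b (a * zs n ^ d) \<and> (\<forall>i<n. a * zs i ^ d + b \<noteq> 0)"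
  proof (cases "\<exists>n. a * zs n ^ d + b = 0")
    case True
    \<comment> \<open>Taking the first pole ensures that the orbit before it is described by
      \<open>F\<close>, as the backward induction requires.\<close>
    define n where "n = (LEAST n. a * zs n ^ d + b = 0)"
    have "a * zs n ^ d + b = 0" using True unfolding n_def by (rule LeastI_ex)
    then have "a * zs n ^ d = - b" by (simp add: add_eq_0_iff2)
    moreover have "\<forall>i<n. a * zs i ^ d + b \<noteq> 0" unfolding n_def using not_less_Least by blast
    ultimately show ?thesis using b0 unfolding exceptional_value_def by (metis neg_equal_0_iff_equal)
  next
    case False
    have orbit: "(psi d a b ^^ n) (affine_pt z) = affine_pt (zs n)" for n
    proof (induction n)
      case (Suc n)
      then show ?case using psi_affine_pt[OF d a b0, of "zs n"] False by (simp add: zs_Suc)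
    qed (simp add: zs_def)
    have "finite (range (\<lambda>n. affine_pt (zs n)))"
      using P by (simp add: PrePer_def orbit flip: b_def)
    then have "finite (affine_pt ` range zs)" by (simp add: image_image)
    then have "finite (range zs)" using affine_pt_inj by (metis finite_imageD inj_on_subset subset_UNIV)
    then have "\<not> inj zs" using finite_imageD by blast
    then obtain i j where ij: "i < j" "zs i = zs j" unfolding inj_def by (metis linorder_neqE_nat)
    have per: "zs (i + n + (j - i)) = zs (i + n)" for n
    proof -
      have "zs (i + n + (j - i)) = (F ^^ n) (zs j)"
        using ij by (simp add: zs_def flip: funpow_add comp_apply[of "F ^^ _" "F ^^ _"])
      also have "\<dots> = (F ^^ n) (zs i)" by (simp only: ij(2))
      also have "\<dots> = zs (i + n)" by (simp add: zs_def add.commute[of i] funpow_add)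
      finally show ?thesis .
    qed
    have "a * zs (i + 0) ^ d + of_int B = 1 \<or> even d \<and> a * zs (i + 0) ^ d + of_int B = - 1"
      by (rule cycle_denominator_unit[OF d a B Bq, of "\<lambda>n. zs (i + n)" "j - i"])
        (use nz False ij per zs_Suc in \<open>auto simp: b_def add.assoc\<close>)
    then have "exceptional_value d b (a * zs i ^ d)"
      using nz[of i] False a by (auto simp: exceptional_value_def b_def algebra_simps)
    then show ?thesis using False by blast
  qed
  then obtain n where "exceptional_value d b (a * zs n ^ d)" "\<forall>i<n. a * zs i ^ d + b \<noteq> 0" by blast
  then have "exceptional_value d b (a * zs 0 ^ d)" using backward by blast
  then show ?thesis by (simp add: b_def zs_def)
qed

theorem theorem1p6:
  fixes d p :: nat and a b :: rat
  assumes "d \<ge> 2" and "prime p" and "a \<noteq> 0" and "b \<in> P0_plus p"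
  shows "finite (PrePer (psi d a b)) \<and> card (PrePer (psi d a b)) \<le> 6"
proof -
  obtain \<sigma> e where \<sigma>: "b = \<sigma> * of_nat p ^ e" "\<sigma> = 1 \<or> \<sigma> = - 1"
    using assms(4) by (auto simp: P0_plus_def)
  define s :: int where "s = (if \<sigma> = 1 then 1 else - 1)"
  define B where "B = s * int p ^ e"
  have b: "b = of_int B" using \<sigma> by (auto simp: B_def s_def)
  have B0: "B \<noteq> 0" using assms(2) by (auto simp: B_def s_def)
  \<comment> \<open>For e = 0 no prime divides B and the claim is vacuous.\<close>
  have Bq: "l = int p" if "prime l" "l dvd B" for l
  proof -
    have "l dvd int p ^ e" using that(2) by (auto simp: B_def s_def split: if_splits)
    then have "l dvd int p" using that(1) by (rule prime_dvd_power[rotated])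
    then show ?thesis using that(1) assms(2) by (simp add: primes_dvd_imp_eq)
  qed
  obtain c1 c2 where c: "\<And>z. exceptional_value d b (a * z ^ d) \<Longrightarrow> a * z ^ d = c1 \<or> a * z ^ d = c2"
    using exceptional_values_two[OF assms(3) B0] unfolding b by blast
  define A where "A c = {z. a * z ^ d = c}" for c
  have A: "finite (A c)" "card (A c) \<le> 2" for c
    using card_power_fibre_le_2[of d a c] assms by (auto simp: A_def)
  \<comment> \<open>Infinity, 0 and two fibres of at most two points each: 1 + 1 + 2 + 2 =
    6.\<close>
  define S where "S = insert infinity_pt (affine_pt ` insert 0 (A c1 \<union> A c2))"
  have sub: "PrePer (psi d a b) \<subseteq> S"
  proof
    fix P assume P: "P \<in> PrePer (psi d a b)"
    show "P \<in> S"
    proof (cases P rule: proj_line_cases)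
      case (2 z)
      then have "z = 0 \<or> a * z ^ d = c1 \<or> a * z ^ d = c2"
        using preperiodic_exceptional[OF assms(1,3) B0 Bq] P c unfolding b by blast
      then show ?thesis using 2 by (auto simp: S_def A_def)
    qed (simp add: S_def)
  qed
  have fin: "finite S" using A by (simp add: S_def)
  have "card S \<le> Suc (card (affine_pt ` insert 0 (A c1 \<union> A c2)))"
    unfolding S_def by (rule card_insert_le_m1) auto
  also have "card (affine_pt ` insert 0 (A c1 \<union> A c2)) \<le> card (insert 0 (A c1 \<union> A c2))"
    using A by (intro card_image_le) auto
  also have "\<dots> \<le> Suc (card (A c1 \<union> A c2))" by (simp add: card_insert_if A)
  also have "card (A c1 \<union> A c2) \<le> card (A c1) + card (A c2)" by (rule card_Un_le)
  finally have "card S \<le> 6" using A(2)[of c1] A(2)[of c2] by linarith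
  then show ?thesis using sub fin by (meson card_mono finite_subset le_trans)
qed

end
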